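(* Let $k\geq 1$ be an integer and let $D$ be a multi-partite tournament containing no directed triangles. If $\delta^+(D)\geq 2k-1$, then $D$ contains $k$ pairwise vertex-disjoint dicycles.
   Context: All graphs are finite. A multi-partite tournament is an orientation of a complete multi-partite graph. A dicycle is a directed cycle; a directed triangle is a dicycle of length $3$. $\delta^+(D)$ denotes the minimum out-degree of $D$. *)

theory Defs
  imports "Graph_Theory.Graph_Theory" "HOL-Library.Disjoint_Sets"
begin

text \<open>
  As usual in \<^theory>\<open>Graph_Theory.Digraph\<close>, an undirected graph is a symmetric loop-free
  digraph. The number of parts is not restricted: a single part gives an edgeless graph.
\<close>
definition complete_multipartite :: "'a pair_pre_digraph \<Rightarrow> bool" where
  "complete_multipartite G \<longleftrightarrow> pair_graph G \<and>
     (\<exists>P. partition_on (pverts G) P \<and>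
        (\<forall>u \<in> pverts G. \<forall>v \<in> pverts G.
           (u, v) \<in> parcs G \<longleftrightarrow> \<not> (\<exists>X \<in> P. u \<in> X \<and> v \<in> X)))"

text \<open>
  Every edge of \<open>G\<close> receives exactly one direction. Parallel arcs of \<open>D\<close> are excluded by
  \<^locale>\<open>digraph\<close>, antiparallel ones by the last conjunct.
\<close>
definition orientation_of :: "('a, 'b) pre_digraph \<Rightarrow> 'a pair_pre_digraph \<Rightarrow> bool" where
  "orientation_of D G \<longleftrightarrow> digraph D \<and> verts D = pverts G \<and>
     arcs_ends D \<union> (arcs_ends D)\<inverse> = parcs G \<and> arcs_ends D \<inter> (arcs_ends D)\<inverse> = {}"

definition multipartite_tournament :: "('a, 'b) pre_digraph \<Rightarrow> bool" where
  "multipartite_tournament D \<longleftrightarrow> (\<exists>G. complete_multipartite G \<and> orientation_of D G)"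

text \<open>Only meaningful if \<open>D\<close> is finite and has at least one vertex.\<close>
definition min_out_degree :: "('a, 'b) pre_digraph \<Rightarrow> nat" where
  "min_out_degree D = Min (out_degree D ` verts D)"

text \<open>
  A dicycle is represented by the list of its arcs. \<^const>\<open>pre_digraph.cycle\<close> admits loops and
  2-cycles, but an orientation of a loop-free graph contains neither.
\<close>
abbreviation dicycle :: "('a, 'b) pre_digraph \<Rightarrow> 'b awalk \<Rightarrow> bool" where
  "dicycle D p \<equiv> pre_digraph.cycle D p"

definition directed_triangle :: "('a, 'b) pre_digraph \<Rightarrow> 'b awalk \<Rightarrow> bool" where
  "directed_triangle D p \<longleftrightarrow> dicycle D p \<and> length p = 3"

definition dicycle_verts :: "('a, 'b) pre_digraph \<Rightarrow> 'b awalk \<Rightarrow> 'a set" where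
  "dicycle_verts D p = tail D ` set p \<union> head D ` set p"

end

theory Submission
  imports Defs
begin

text \<open>
  Induction on \<open>k\<close>. Minimum out-degree at least 1 gives a closed walk, and multipartiteness shortens
  it to a 4-cycle \<open>C\<close>. Since there are no triangles, opposite vertices of \<open>C\<close> lie in the same part,
  and a vertex adjacent to all of \<open>C\<close> either dominates \<open>C\<close> or is dominated by \<open>C\<close>. Let \<open>A\<close> be the
  set of vertices dominating \<open>C\<close>, and \<open>T\<close> the set of vertices outside \<open>A\<close> that send no arc to \<open>A\<close>.
  Then \<open>T\<close> contains \<open>C\<close>, no arc leaves \<open>T\<close>, and every vertex of \<open>T\<close> has at most two
  out-neighbours on \<open>C\<close>. So all out-degrees drop by at most two on passing to \<open>T - C\<close>.
\<close>

section \<open>Triangle-free multipartite tournaments as relations\<close>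

definition four_cycle_on :: "'a rel \<Rightarrow> 'a set \<Rightarrow> bool" where
  "four_cycle_on r C \<longleftrightarrow>
     (\<exists>a b c d. C = {a, b, c, d} \<and> (a, b) \<in> r \<and> (b, c) \<in> r \<and> (c, d) \<in> r \<and> (d, a) \<in> r)"

text \<open>Multipartiteness enters only through \<open>adjacent_cases\<close>, which in
  contrapositive form says that non-adjacency is transitive. With no partition mentioned, the axioms
  pass to any subset of \<open>V\<close> while \<open>r\<close> stays fixed.\<close>

locale triangle_free_multipartite =
  fixes V :: "'a set" and r :: "'a rel"
  assumes finite_V: "finite V"
    and asym: "(u, v) \<in> r \<Longrightarrow> (v, u) \<notin> r"
    and adjacent_cases: "\<lbrakk>u \<in> V; v \<in> V; w \<in> V; (u, w) \<in> r\<rbrakk> \<Longrightarrow>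
      (u, v) \<in> r \<or> (v, u) \<in> r \<or> (v, w) \<in> r \<or> (w, v) \<in> r"
    and no_triangle: "\<lbrakk>(u, v) \<in> r; (v, w) \<in> r\<rbrakk> \<Longrightarrow> (w, u) \<notin> r"
begin

lemma subset:
  assumes "W \<subseteq> V"
  shows "triangle_free_multipartite W r"
proof
  show "finite W"
    using assms finite_V by (rule finite_subset)
next
  fix u v w
  assume "u \<in> W" "v \<in> W" "w \<in> W" "(u, w) \<in> r"
  then show "(u, v) \<in> r \<or> (v, u) \<in> r \<or> (v, w) \<in> r \<or> (w, v) \<in> r"
    using assms by (intro adjacent_cases) auto
qed (fact asym no_triangle)+

section \<open>Existence of a 4-cycle\<close>

lemma closed_walk_imp_four_cycle:
  assumes "(x, x) \<in> (r \<inter> V \<times> V) ^^ n" "n > 0"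
  shows "\<exists>C \<subseteq> V. four_cycle_on r C"
  using assms
proof (induction n arbitrary: x rule: less_induct)
  case (less n)
  let ?r = "r \<inter> V \<times> V"
  consider "n = 1" | "n = 2" | "n = 3" | m where "n = Suc (Suc (Suc (Suc m)))"
    using less.prems(2)
    by (metis One_nat_def gr0_conv_Suc numeral_2_eq_2 numeral_3_eq_3 not0_implies_Suc)
  then show ?case
  proof cases
    case 1
    then show ?thesis using less.prems asym by auto
  next
    case 2
    then show ?thesis using less.prems asym by (auto simp: numeral_2_eq_2)
  next
    case 3
    then show ?thesis using less.prems no_triangle by (auto simp: numeral_3_eq_3)
  next
    case 4
    then obtain w1 w2 w3 where w: "(x, w1) \<in> ?r" "(w1, w2) \<in> ?r" "(w2, w3) \<in> ?r"
      and rest: "(w3, x) \<in> ?r ^^ Suc m"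
      using less.prems(1) by (metis relpow_Suc_D2)
    then have V: "x \<in> V" "w1 \<in> V" "w2 \<in> V" "w3 \<in> V" by auto
    \<comment> \<open>Since \<open>w2\<close> and \<open>w3\<close> are adjacent, \<open>x\<close>
      is adjacent to one of them. The four cases give a triangle, closed walks shorter by one and by
      two, and a 4-cycle.\<close>
    consider "(w2, x) \<in> r" | "(x, w2) \<in> r" | "(x, w3) \<in> r" | "(w3, x) \<in> r"
      using adjacent_cases[of w2 x w3] V w by auto
    then show ?thesis
    proof cases
      case 1
      then show ?thesis using no_triangle w by blast
    next
      case 2
      then have "(x, x) \<in> ?r ^^ Suc (Suc (Suc m))"
        using w V rest by (meson Int_iff SigmaI relpow_Suc_I2)
      then show ?thesis using less.IH 4 by blast
    next
      case 3
      then have "(x, x) \<in> ?r ^^ Suc (Suc m)"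
        using w V rest by (meson Int_iff SigmaI relpow_Suc_I2)
      then show ?thesis using less.IH 4 by (metis lessI less_SucI zero_less_Suc)
    next
      case 4
      then have "four_cycle_on r {x, w1, w2, w3}"
        using w unfolding four_cycle_on_def by blast
      then show ?thesis using V by (intro exI[of _ "{x, w1, w2, w3}"]) auto
    qed
  qed
qed

text \<open>If the arcs inside \<open>V\<close> were acyclic, finiteness would yield a sink,
  contradicting the second assumption. So some closed walk exists.\<close>

lemma ex_four_cycle:
  assumes "V \<noteq> {}" "\<And>v. v \<in> V \<Longrightarrow> r `` {v} \<inter> V \<noteq> {}"
  shows "\<exists>C \<subseteq> V. four_cycle_on r C"
proof -
  let ?r = "r \<inter> V \<times> V"
  have "\<not> acyclic ?r"
  proof
    assume "acyclic ?r"
    then have "wf (?r\<inverse>)"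
      using finite_V by (intro finite_acyclic_wf_converse) auto
    then obtain z where "z \<in> V" "\<And>y. (y, z) \<in> ?r\<inverse> \<Longrightarrow> y \<notin> V"
      using assms(1) by (metis wf_eq_minimal ex_in_conv)
    then show False using assms(2)[of z] by blast
  qed
  then obtain x n where "(x, x) \<in> ?r ^^ n" "n > 0"
    by (auto simp: acyclic_def trancl_power)
  then show ?thesis by (rule closed_walk_imp_four_cycle)
qed

section \<open>Removing a 4-cycle\<close>

context
  fixes C
  assumes C: "four_cycle_on r C" "C \<subseteq> V"
begin

text \<open>Domination spreads along the arcs of \<open>C\<close>: if \<open>v\<close> beats
  \<open>p\<close> and \<open>p\<close> beats \<open>q\<close>, an arc from \<open>q\<close> to
  \<open>v\<close> would close a triangle, so the edge between \<open>v\<close> and \<open>q\<close>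
  starts at \<open>v\<close>.\<close>

lemma four_cycle_dominates:
  assumes "v \<in> V" "x \<in> C" "(v, x) \<in> r" "\<And>y. y \<in> C \<Longrightarrow> (v, y) \<in> r \<or> (y, v) \<in> r"
    and "y \<in> C"
  shows "(v, y) \<in> r"
proof -
  obtain a b c d where abcd: "C = {a, b, c, d}"
    "(a, b) \<in> r" "(b, c) \<in> r" "(c, d) \<in> r" "(d, a) \<in> r"
    using C by (auto simp: four_cycle_on_def)
  have step: "(v, q) \<in> r" if "(v, p) \<in> r" "(p, q) \<in> r" "q \<in> C" for p q
    using that no_triangle assms(4) by blast
  show ?thesis
    using assms(2,3,5) abcd step[of a b] step[of b c] step[of c d] step[of d a] by auto
qed

text \<open>\<open>X\<close> and \<open>Y\<close> are the two pairs of opposite vertices. Opposite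
  vertices are non-adjacent, as an arc between them would close a triangle; hence a vertex adjacent
  to one of them is adjacent to both.\<close>

lemma four_cycle_bipartition:
  obtains X Y where "C = X \<union> Y" "finite X" "finite Y" "card X \<le> 2" "card Y \<le> 2"
    and "\<And>v x y z. \<lbrakk>v \<in> V; x \<in> X; y \<in> Y; (v, x) \<in> r; (v, y) \<in> r; z \<in> C\<rbrakk> \<Longrightarrow>
      (v, z) \<in> r \<or> (z, v) \<in> r"
proof -
  obtain a b c d where abcd: "C = {a, b, c, d}"
    "(a, b) \<in> r" "(b, c) \<in> r" "(c, d) \<in> r" "(d, a) \<in> r"
    using C by (auto simp: four_cycle_on_def)
  have V: "a \<in> V" "b \<in> V" "c \<in> V" "d \<in> V" using abcd C by auto
  have opp: "(a, c) \<notin> r" "(c, a) \<notin> r" "(b, d) \<notin> r" "(d, b) \<notin> r"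
    using abcd no_triangle by blast+
  have "(v, z) \<in> r \<or> (z, v) \<in> r"
    if "v \<in> V" "x \<in> {a, c}" "y \<in> {b, d}" "(v, x) \<in> r" "(v, y) \<in> r" "z \<in> C" for v x y z
    using that abcd(1) V opp adjacent_cases[of v a c] adjacent_cases[of v c a]
      adjacent_cases[of v b d] adjacent_cases[of v d b] by auto
  moreover have "C = {a, c} \<union> {b, d}" using abcd by auto
  ultimately show thesis
    using that[of "{a, c}" "{b, d}"] by (simp add: card_insert_if)
qed

text \<open>This is the set \<open>A\<close> of the overview; \<open>remainder\<close> is
  \<open>T\<close>.\<close>

definition dominators :: "'a set" where
  "dominators = {v \<in> V. \<forall>x \<in> C. (v, x) \<in> r}"

definition remainder :: "'a set" where
  "remainder = {v \<in> V - dominators. r `` {v} \<inter> dominators = {}}"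

lemma four_cycle_subset_remainder: "C \<subseteq> remainder"
  using C asym by (auto simp: remainder_def dominators_def)

lemma remainder_closed:
  assumes t: "t \<in> remainder" and s: "s \<in> V" "(t, s) \<in> r"
  shows "s \<in> remainder"
proof (rule ccontr)
  assume "s \<notin> remainder"
  then obtain v where v: "v \<in> dominators" "(s, v) \<in> r"
    using t s by (auto simp: remainder_def)
  \<comment> \<open>An arc from \<open>t\<close> to \<open>v\<close> is excluded by the choice of
    \<open>t\<close>, the reverse one by the triangle through \<open>s\<close>. So \<open>t\<close>
    lies in the part of \<open>v\<close> and, like \<open>v\<close>, is adjacent to all of
    \<open>C\<close>.\<close>
  have tV: "t \<in> V" and tv: "(t, v) \<notin> r" "(v, t) \<notin> r"
    using t v no_triangle[OF s(2) v(2)] by (auto simp: remainder_def)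
  have vx: "v \<in> V" "(v, x) \<in> r" if "x \<in> C" for x
    using v that by (auto simp: dominators_def)
  have adj: "(t, x) \<in> r \<or> (x, t) \<in> r" if "x \<in> C" for x
    using adjacent_cases[of v t x] vx[OF that] tV tv C that by auto
  \<comment> \<open>A single arc from \<open>t\<close> to \<open>C\<close> would make
    \<open>t\<close> a dominator.\<close>
  have xt: "(x, t) \<in> r" if "x \<in> C" for x
  proof (rule ccontr)
    assume "(x, t) \<notin> r"
    then have "t \<in> dominators"
      using four_cycle_dominates[OF tV that _ adj] adj that tV by (auto simp: dominators_def)
    then show False using t by (simp add: remainder_def)
  qed
  obtain p q where pq: "p \<in> C" "q \<in> C" "(p, q) \<in> r"
    using C by (auto simp: four_cycle_on_def)
  \<comment> \<open>An arc from \<open>s\<close> to \<open>x\<close> would close the triangle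
    \<open>t\<close>, \<open>s\<close>, \<open>x\<close>; an arc from \<open>x\<close> to
    \<open>s\<close> the triangle \<open>s\<close>, \<open>v\<close>, \<open>x\<close>. But
    \<open>s\<close> cannot be non-adjacent to both ends of the arc from \<open>p\<close> to
    \<open>q\<close>.\<close>
  have "(s, x) \<notin> r \<and> (x, s) \<notin> r" if "x \<in> C" for x
    using no_triangle[OF s(2), of x] no_triangle[OF v(2), of x] xt[OF that] vx(2)[OF that] by auto
  moreover have "p \<in> V" "q \<in> V"
    using pq C(2) by auto
  ultimately show False
    using adjacent_cases[of p s q] pq s(1) by simp
qed

text \<open>Out-neighbours in both opposite pairs would make \<open>t\<close> adjacent to all of
  \<open>C\<close>, hence a dominator. So they all lie in one pair.\<close>

lemma card_out_four_cycle_le: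
  assumes t: "t \<in> remainder"
  shows "card (r `` {t} \<inter> C) \<le> 2"
proof -
  obtain X Y where XY: "C = X \<union> Y" "finite X" "finite Y" "card X \<le> 2" "card Y \<le> 2"
    and adj: "\<And>v x y z. \<lbrakk>v \<in> V; x \<in> X; y \<in> Y; (v, x) \<in> r; (v, y) \<in> r; z \<in> C\<rbrakk> \<Longrightarrow>
      (v, z) \<in> r \<or> (z, v) \<in> r"
    by (rule four_cycle_bipartition) blast
  have tV: "t \<in> V" "t \<notin> dominators" using t by (auto simp: remainder_def)
  have "(t, x) \<notin> r \<or> (t, y) \<notin> r" if "x \<in> X" "y \<in> Y" for x y
  proof (rule ccontr)
    assume "\<not> ?thesis"
    then have out: "(t, x) \<in> r" "(t, y) \<in> r" by auto
    have "(t, z) \<in> r" if "z \<in> C" for z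
      using four_cycle_dominates[OF tV(1) _ out(1) adj[OF tV(1) \<open>x \<in> X\<close> \<open>y \<in> Y\<close> out] that]
        \<open>x \<in> X\<close> XY(1) by blast
    then show False using tV by (simp add: dominators_def)
  qed
  then have "r `` {t} \<inter> C \<subseteq> X \<or> r `` {t} \<inter> C \<subseteq> Y"
    using XY(1) by auto
  then show ?thesis
    using card_mono[OF XY(2)] card_mono[OF XY(3)] XY(4,5) by (meson order_trans)
qed

lemma card_out_remainder_ge:
  assumes t: "t \<in> remainder"
  shows "card (r `` {t} \<inter> V) \<le> card (r `` {t} \<inter> (remainder - C)) + 2"
proof -
  have "r `` {t} \<inter> V = (r `` {t} \<inter> (remainder - C)) \<union> (r `` {t} \<inter> C)"
    using remainder_closed[OF t] C by (auto simp: remainder_def)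
  then have "card (r `` {t} \<inter> V) \<le> card (r `` {t} \<inter> (remainder - C)) + card (r `` {t} \<inter> C)"
    by (metis card_Un_le)
  with card_out_four_cycle_le[OF t] show ?thesis by linarith
qed

end

end

section \<open>Induction on the number of cycles\<close>

lemma disjoint_four_cycles:
  assumes "triangle_free_multipartite V r"
    and "k > 0 \<Longrightarrow> V \<noteq> {}"
    and "\<And>v. v \<in> V \<Longrightarrow> 2 * k - 1 \<le> card (r `` {v} \<inter> V)"
  shows "\<exists>c :: nat \<Rightarrow> 'a set. (\<forall>i < k. c i \<subseteq> V \<and> four_cycle_on r (c i)) \<and>
    disjoint_family_on c {..<k}"
  using assms
proof (induction k arbitrary: V)
  case 0
  show ?case by (simp add: disjoint_family_on_def)
next
  case (Suc k)
  interpret triangle_free_multipartite V r by fact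
  have "r `` {v} \<inter> V \<noteq> {}" if "v \<in> V" for v
    using Suc.prems(3)[OF that] by auto
  then obtain C where C: "four_cycle_on r C" "C \<subseteq> V"
    using ex_four_cycle Suc.prems(2) by blast
  let ?W = "remainder C - C"
  have W: "?W \<subseteq> V" by (auto simp: remainder_def[OF C])
  \<comment> \<open>The bound \<open>2 * Suc k - 1\<close> drops by two. It is stated for vertices
    of \<open>C\<close> as well, because one of them then provides an out-neighbour in
    \<open>?W\<close>, showing \<open>?W\<close> non-empty when \<open>k > 0\<close>.\<close>
  have deg: "2 * k - 1 \<le> card (r `` {v} \<inter> ?W)" if "v \<in> remainder C" for v
    using card_out_remainder_ge[OF C that] Suc.prems(3)[of v] that
    by (auto simp: remainder_def[OF C])
  have "?W \<noteq> {}" if "k > 0"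
  proof -
    obtain x where "x \<in> C" using C by (auto simp: four_cycle_on_def)
    then have "0 < card (r `` {x} \<inter> ?W)"
      using deg[of x] four_cycle_subset_remainder[OF C] that by fastforce
    then show ?thesis by (metis Int_empty_right card.empty less_irrefl)
  qed
  then obtain c where c: "\<And>i. i < k \<Longrightarrow> c i \<subseteq> ?W \<and> four_cycle_on r (c i)"
      "disjoint_family_on c {..<k}"
    using Suc.IH[OF subset[OF W]] deg by (metis DiffD1)
  let ?c = "c(k := C)"
  have "\<forall>i < Suc k. ?c i \<subseteq> V \<and> four_cycle_on r (?c i)"
    using c(1) C W by (auto simp: less_Suc_eq)
  moreover have "disjoint_family_on ?c {..<Suc k}"
    using c unfolding disjoint_family_on_def
    by (auto simp: less_Suc_eq) blast+
  ultimately show ?case by blast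
qed

section \<open>Transfer between relations and digraphs\<close>

lemma arcs_endsE:
  assumes "(u, v) \<in> arcs_ends D"
  obtains e where "e \<in> arcs D" "tail D e = u" "head D e = v"
  using assms by (auto simp: arcs_ends_conv)

lemma (in loopfree_digraph) ex_directed_triangle:
  assumes "(a, b) \<in> arcs_ends G" "(b, c) \<in> arcs_ends G" "(c, a) \<in> arcs_ends G"
  shows "\<exists>p. directed_triangle G p"
proof -
  obtain e f g where "e \<in> arcs G" "tail G e = a" "head G e = b"
    "f \<in> arcs G" "tail G f = b" "head G f = c" "g \<in> arcs G" "tail G g = c" "head G g = a"
    using assms by (metis arcs_endsE)
  moreover from this have "a \<in> verts G" "a \<noteq> b" "b \<noteq> c" "c \<noteq> a"
    using no_loops by force+
  ultimately have "directed_triangle G [e, f, g]"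
    by (auto simp: directed_triangle_def cycle_def awalk_def intro!: exI[of _ a])
  then show ?thesis by blast
qed

lemma (in loopfree_digraph) dicycle_of_four_cycle:
  assumes "four_cycle_on (arcs_ends G) C"
    and asym: "arcs_ends G \<inter> (arcs_ends G)\<inverse> = {}"
  shows "\<exists>p. dicycle G p \<and> dicycle_verts G p = C"
proof -
  obtain a b c d where C: "C = {a, b, c, d}" and abcd: "(a, b) \<in> arcs_ends G"
    "(b, c) \<in> arcs_ends G" "(c, d) \<in> arcs_ends G" "(d, a) \<in> arcs_ends G"
    using assms(1) by (auto simp: four_cycle_on_def)
  then obtain e f g h where "e \<in> arcs G" "tail G e = a" "head G e = b"
    "f \<in> arcs G" "tail G f = b" "head G f = c" "g \<in> arcs G" "tail G g = c" "head G g = d"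
    "h \<in> arcs G" "tail G h = d" "head G h = a"
    by (metis arcs_endsE)
  moreover from this have "a \<in> verts G" "a \<noteq> b" "b \<noteq> c" "c \<noteq> d" "d \<noteq> a"
    using no_loops by force+
  \<comment> \<open>If opposite vertices coincided, two consecutive arcs would be
    antiparallel.\<close>
  moreover have "a \<noteq> c" "b \<noteq> d"
    using abcd asym by auto
  ultimately have "dicycle G [e, f, g, h]" "dicycle_verts G [e, f, g, h] = C"
    by (auto simp: cycle_def awalk_def dicycle_verts_def C intro!: exI[of _ a])
  then show ?thesis by blast
qed

text \<open>Without parallel arcs, \<open>head G\<close> is injective on the arcs leaving
  \<open>v\<close>, so counting arcs is counting out-neighbours.\<close>

lemma (in digraph) card_out_neighbours:
  "card (arcs_ends G `` {v} \<inter> verts G) = out_degree G v"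
proof -
  have "arcs_ends G `` {v} \<inter> verts G = head G ` out_arcs G v"
    by (auto simp: arcs_ends_conv out_arcs_def)
  moreover have "inj_on (head G) (out_arcs G v)"
    by (auto simp: inj_on_def arc_to_ends_def intro: no_multi_arcs)
  ultimately show ?thesis
    by (simp add: card_image out_degree_def)
qed

lemma multipartite_tournament_triangle_free:
  assumes D: "multipartite_tournament D" and no_tri: "\<not> (\<exists>p. directed_triangle D p)"
  shows "triangle_free_multipartite (verts D) (arcs_ends D)"
proof -
  obtain G P where G: "orientation_of D G" "partition_on (pverts G) P"
    and P: "\<forall>u \<in> pverts G. \<forall>v \<in> pverts G.
      (u, v) \<in> parcs G \<longleftrightarrow> \<not> (\<exists>X \<in> P. u \<in> X \<and> v \<in> X)"
    using D by (auto simp: multipartite_tournament_def complete_multipartite_def)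
  interpret digraph D using G by (simp add: orientation_of_def)
  have eq: "verts D = pverts G" "parcs G = arcs_ends D \<union> (arcs_ends D)\<inverse>"
    and asym: "arcs_ends D \<inter> (arcs_ends D)\<inverse> = {}"
    using G by (auto simp: orientation_of_def)
  show ?thesis
  proof
    show "finite (verts D)" by simp
  next
    fix u v assume "(u, v) \<in> arcs_ends D"
    then show "(v, u) \<notin> arcs_ends D" using asym by auto
  next
    fix u v w
    assume V: "u \<in> verts D" "v \<in> verts D" "w \<in> verts D" and uw: "(u, w) \<in> arcs_ends D"
    \<comment> \<open>Otherwise the part shared by \<open>u\<close> and \<open>v\<close> meets the
      part shared by \<open>v\<close> and \<open>w\<close> in \<open>v\<close>. The two coincide, so
      \<open>u\<close> and \<open>w\<close> would be non-adjacent.\<close>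
    have "(u, v) \<in> parcs G \<or> (v, w) \<in> parcs G"
    proof (rule ccontr)
      assume "\<not> ?thesis"
      then obtain X Y where XY: "X \<in> P" "u \<in> X" "v \<in> X" "Y \<in> P" "v \<in> Y" "w \<in> Y"
        using P V eq(1) by auto
      then have "X = Y"
        using partition_onD2[OF G(2)] by (auto simp: disjoint_def)
      then have "(u, w) \<notin> parcs G" using XY P V eq(1) by auto
      then show False using uw eq by auto
    qed
    then show "(u, v) \<in> arcs_ends D \<or> (v, u) \<in> arcs_ends D \<or>
        (v, w) \<in> arcs_ends D \<or> (w, v) \<in> arcs_ends D"
      using eq by auto
  next
    fix u v w assume "(u, v) \<in> arcs_ends D" "(v, w) \<in> arcs_ends D"
    then show "(w, u) \<notin> arcs_ends D"
      using ex_directed_triangle no_tri by blast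
  qed
qed

theorem corollary15:
  fixes D :: "('a, 'b) pre_digraph" and k :: nat
  assumes "k \<ge> 1"
    and "multipartite_tournament D"
    and "verts D \<noteq> {}"
    and "\<not> (\<exists>p. directed_triangle D p)"
    and "min_out_degree D \<ge> 2 * k - 1"
  shows "\<exists>c :: nat \<Rightarrow> 'b awalk.
           (\<forall>i < k. dicycle D (c i)) \<and>
           disjoint_family_on (\<lambda>i. dicycle_verts D (c i)) {..<k}"
proof -
  have D: "digraph D" and asym: "arcs_ends D \<inter> (arcs_ends D)\<inverse> = {}"
    using assms(2) by (auto simp: multipartite_tournament_def orientation_of_def)
  interpret digraph D by fact
  have "2 * k - 1 \<le> card (arcs_ends D `` {v} \<inter> verts D)" if "v \<in> verts D" for v
  proof -
    have "min_out_degree D \<le> out_degree D v"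
      using that by (simp add: min_out_degree_def)
    then show ?thesis using assms(5) by (simp add: card_out_neighbours)
  qed
  then obtain C where C: "\<And>i. i < k \<Longrightarrow> four_cycle_on (arcs_ends D) (C i)"
    "disjoint_family_on C {..<k}"
    using disjoint_four_cycles[OF multipartite_tournament_triangle_free[OF assms(2,4)]] assms(3)
    by metis
  have "\<forall>i. \<exists>p. i < k \<longrightarrow> dicycle D p \<and> dicycle_verts D p = C i"
    using C(1) dicycle_of_four_cycle asym by blast
  then obtain c where c: "\<And>i. i < k \<Longrightarrow> dicycle D (c i) \<and> dicycle_verts D (c i) = C i"
    by metis
  then have "disjoint_family_on (\<lambda>i. dicycle_verts D (c i)) {..<k}"
    using C(2) by (simp add: disjoint_family_on_def)
  with c show ?thesis by blast
qed

end
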